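(* Let $k\ge 2$ and let $f:\mathcal{S}^k\times\mathcal{M}^{k(k-1)/2}\to\mathbb{R}$ be a bounded measurable function. For any $j,n\ge 1$, the generalized $U$-statistic $$S_{n,k}(f)=\sum_{\beta\in[n]^k_{\neq}} f\big(X_{\beta(1)},\dots,X_{\beta(k)},Y_{\beta(1),\beta(2)},\dots,Y_{\beta(1),\beta(k)},Y_{\beta(2),\beta(3)},\dots,Y_{\beta(k-1),\beta(k)}\big)$$ satisfies $$\mathbb{E}\big[(S_{n,k}(f))^j\big]=\sum_{\substack{\rho\in\Pi([j]\times[k])\\ \rho\wedge\pi=\widehat{0}}}\frac{n!}{(n-|\rho|)!}\int_{\mathcal{S}^{|\rho|}\times\mathcal{M}^{e(\rho_{K_k})}}\Big(\bigotimes_{i=1}^j f\Big)_{\rho}(\mathbf{x},\mathbf{y})\,\mu^{\otimes|\rho|}(\mathrm{d}\mathbf{x})\,\mathbb{Q}^{\otimes e(\rho_{K_k})}(\mathrm{d}\mathbf{y}),$$ where the sum runs over all non-flat partitions $\rho$ of $[j]\times[k]$.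
   Context: Setting. $\mathcal{S}$ is a Borel space and $\mathcal{M}$ is a measurable space. $\{X_i\}_{1\le i\le n}$ are i.i.d. $\mathcal{S}$-valued random variables with common continuous (atomless) distribution $\mu$; $\{Y_{i,j}\}_{1\le i<j\le n}$ are i.i.d. $\mathcal{M}$-valued random variables with common distribution $\mathbb{Q}$; the two families are independent of each other, and $Y_{i,j}:=Y_{j,i}$ for $j<i$. $[n]:=\{1,\dots,n\}$ and $[n]^k_{\neq}:=\{\beta\in[n]^k:\beta(i)\neq\beta(j)\text{ for }1\le i\ne j\le k\}$. The arguments $Y_{\beta(u),\beta(v)}$ of $f$ are listed over pairs $1\le u<v\le k$ in lexicographic order. Partitions. $\Pi(b)$ is the set of partitions of a finite set $b$, and $|\rho|$ is the number of blocks of $\rho$. $\rho\wedge\rho'$ is the coarsest partition finer than both $\rho$ and $\rho'$; $\widehat{0}$ is the partition into singletons. $\pi=\{\pi_1,\dots,\pi_j\}\in\Pi([j]\times[k])$ with rows $\pi_i=\{(i,\ell):1\le\ell\le k\}$. A partition $\rho\in\Pi([j]\times[k])$ is non-flat if $\rho\wedge\pi=\widehat{0}$, i.e. no block contains two elements of the same row. The graph $\rho_{K_k}$. For $\rho=\{b_1,\dots,b_{|\rho|}\}$ non-flat, $\rho_{K_k}$ is the simple graph whose vertices are the blocks of $\rho$, with an edge between two distinct blocks $b_\nu,b_\upsilon$ if and only if there exist $i\in[j]$ and $l_1\neq l_2$ in $[k]$ with $(i,l_1)\in b_\nu$ and $(i,l_2)\in b_\upsilon$; $e(\rho_{K_k})$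 is its number of edges. The function $(\bigotimes_{i=1}^j f)_\rho:\mathcal{S}^{|\rho|}\times\mathcal{M}^{e(\rho_{K_k})}\to\mathbb{R}$ takes one variable $x_\nu\in\mathcal{S}$ for each block $b_\nu$ and one variable $y_{(\nu,\upsilon)}=y_{(\upsilon,\nu)}\in\mathcal{M}$ for each edge $\{b_\nu,b_\upsilon\}$ of $\rho_{K_k}$, and equals $\prod_{i=1}^j f\big(x^{(i)}_1,\dots,x^{(i)}_k,y^{(i)}_{1,2},\dots,y^{(i)}_{k-1,k}\big)$, where $x^{(i)}_\ell:=x_\nu$ if $(i,\ell)\in b_\nu$, and $y^{(i)}_{u,v}:=y_{(t,s)}$ if $(i,u)\in b_t$ and $(i,v)\in b_s$. Convention: $n!/(n-r)!$ denotes the falling factorial $n(n-1)\cdots(n-r+1)$, equal to $0$ if $r>n$. *)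

theory Defs
  imports "HOL-Probability.Probability"
begin

text \<open>
  A Borel space is a measurable space that is isomorphic, as a measurable space, to a Borel
  subset of the real line. A measurable space is represented by a measure whose measure values
  are ignored.
\<close>

definition borel_space :: "'s measure \<Rightarrow> bool" where
  "borel_space S \<longleftrightarrow>
     (\<exists>B\<in>sets (borel :: real measure).
      \<exists>g\<in>measurable S (restrict_space borel B). \<exists>h\<in>measurable (restrict_space borel B) S.
        (\<forall>x\<in>space S. h (g x) = x) \<and> (\<forall>y\<in>B. g (h y) = y))"

definition atomless :: "'s measure \<Rightarrow> bool" where
  "atomless \<mu> \<longleftrightarrow>
     (\<forall>A\<in>sets \<mu>. 0 < emeasure \<mu> A \<longrightarrow>
        (\<exists>B\<in>sets \<mu>. B \<subseteq> A \<and> 0 < emeasure \<mu> B \<and> emeasure \<mu> B < emeasure \<mu> A))"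

definition pairs :: "nat \<Rightarrow> (nat \<times> nat) set" where
  "pairs m = {(u, v). 1 \<le> u \<and> u < v \<and> v \<le> m}"

text \<open>
  The domain of \<open>f\<close>. The second factor is indexed by the \<open>k(k-1)/2\<close> pairs \<open>u < v\<close> themselves,
  rather than by their positions in the lexicographic order.
\<close>

definition kernel_domain ::
  "nat \<Rightarrow> 's measure \<Rightarrow> 'm measure \<Rightarrow> ((nat \<Rightarrow> 's) \<times> (nat \<times> nat \<Rightarrow> 'm)) measure" where
  "kernel_domain k S T = Pi\<^sub>M {1..k} (\<lambda>_. S) \<Otimes>\<^sub>M Pi\<^sub>M (pairs k) (\<lambda>_. T)"

definition inj_tuples :: "nat \<Rightarrow> nat \<Rightarrow> (nat \<Rightarrow> nat) set" where
  "inj_tuples n k = {\<beta> \<in> {1..k} \<rightarrow>\<^sub>E {1..n}. inj_on \<beta> {1..k}}"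

definition gen_U_statistic ::
  "nat \<Rightarrow> nat \<Rightarrow> ((nat \<Rightarrow> 's) \<times> (nat \<times> nat \<Rightarrow> 'm) \<Rightarrow> real) \<Rightarrow>
   (nat \<Rightarrow> 'w \<Rightarrow> 's) \<Rightarrow> (nat \<Rightarrow> nat \<Rightarrow> 'w \<Rightarrow> 'm) \<Rightarrow> 'w \<Rightarrow> real" where
  "gen_U_statistic n k f X Y \<omega> =
     (\<Sum>\<beta>\<in>inj_tuples n k.
        f (\<lambda>l\<in>{1..k}. X (\<beta> l) \<omega>, \<lambda>(u, v)\<in>pairs k. Y (\<beta> u) (\<beta> v) \<omega>))"

definition grid :: "nat \<Rightarrow> nat \<Rightarrow> (nat \<times> nat) set" where
  "grid j k = {1..j} \<times> {1..k}"

definition rows :: "nat \<Rightarrow> nat \<Rightarrow> (nat \<times> nat) set set" where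
  "rows j k = (\<lambda>i. {i} \<times> {1..k}) ` {1..j}"

definition non_flat_partitions :: "nat \<Rightarrow> nat \<Rightarrow> (nat \<times> nat) set set set" where
  "non_flat_partitions j k =
     {\<rho>. partition_on (grid j k) \<rho> \<and>
         common_refinement {\<rho>, rows j k} = (\<lambda>p. {p}) ` grid j k}"

text \<open>
  The edge set of the simple graph \<open>\<rho>\<^bsub>K\<^sub>k\<^esub>\<close> on the vertex set \<open>\<rho>\<close>; an edge is the unordered pair of
  its two endpoints.
\<close>

definition edges :: "nat \<Rightarrow> nat \<Rightarrow> (nat \<times> nat) set set \<Rightarrow> (nat \<times> nat) set set set" where
  "edges j k \<rho> =
     {{b, c} | b c. b \<in> \<rho> \<and> c \<in> \<rho> \<and> b \<noteq> c \<and>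
        (\<exists>i\<in>{1..j}. \<exists>l1\<in>{1..k}. \<exists>l2\<in>{1..k}. l1 \<noteq> l2 \<and> (i, l1) \<in> b \<and> (i, l2) \<in> c)}"

definition block_of :: "(nat \<times> nat) set set \<Rightarrow> nat \<times> nat \<Rightarrow> (nat \<times> nat) set" where
  "block_of \<rho> p = (THE b. b \<in> \<rho> \<and> p \<in> b)"

text \<open>
  The variables of \<open>(\<Otimes>\<^sub>i f)\<^sub>\<rho>\<close> are indexed by the blocks and by the edges themselves, so no enumeration
  of the blocks is chosen.
\<close>

definition tensor_glued ::
  "nat \<Rightarrow> nat \<Rightarrow> ((nat \<Rightarrow> 's) \<times> (nat \<times> nat \<Rightarrow> 'm) \<Rightarrow> real) \<Rightarrow> (nat \<times> nat) set set \<Rightarrow>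
   ((nat \<times> nat) set \<Rightarrow> 's) \<times> ((nat \<times> nat) set set \<Rightarrow> 'm) \<Rightarrow> real" where
  "tensor_glued j k f \<rho> = (\<lambda>(x, y).
     \<Prod>i\<in>{1..j}.
        f (\<lambda>l\<in>{1..k}. x (block_of \<rho> (i, l)),
           \<lambda>(u, v)\<in>pairs k. y {block_of \<rho> (i, u), block_of \<rho> (i, v)}))"

definition falling_factorial :: "nat \<Rightarrow> nat \<Rightarrow> real" where
  "falling_factorial n r = (\<Prod>i<r. real n - real i)"

end

theory Submission
  imports Defs
begin

text \<open>
  Expanding the power gives a sum over \<open>j\<close>-tuples of injective maps \<open>\<beta>\<^sub>i : [k] \<rightarrow> [n]\<close>, that is, over maps
  \<open>[j] \<times> [k] \<rightarrow> [n]\<close> that are injective on every row. Such a map is the same thing as its partition \<open>\<rho>\<close>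
  into fibres, which is non-flat, together with an injective labelling of the blocks of \<open>\<rho>\<close> by \<open>[n]\<close>.
  Distinct blocks carry distinct labels, so distinct edges of \<open>\<rho>\<^bsub>K\<^sub>k\<^esub>\<close> carry distinct label pairs; the
  variables entering the summand are therefore independent, and its expectation is the integral
  attached to \<open>\<rho>\<close>, whatever the labelling. There are \<open>n!/(n-|\<rho>|)!\<close> labellings.
\<close>

subsection \<open>Row-injective maps as labelled non-flat partitions\<close>

lemma block_of_eq:
  assumes "partition_on A \<rho>" "b \<in> \<rho>" "p \<in> b"
  shows "block_of \<rho> p = b"
  unfolding block_of_def
  using assms partition_onD2[OF assms(1)] by (intro the_equality) (auto dest: disjointD)

lemma block_of_in:
  assumes "partition_on A \<rho>" "p \<in> A"
  shows "block_of \<rho> p \<in> \<rho>" "p \<in> block_of \<rho> p"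
proof -
  obtain b where "b \<in> \<rho>" "p \<in> b"
    using assms partition_onD1 by fastforce
  with block_of_eq[OF assms(1)] show "block_of \<rho> p \<in> \<rho>" "p \<in> block_of \<rho> p" by auto
qed

lemma partition_on_rows:
  assumes "k \<ge> 1" shows "partition_on (grid j k) (rows j k)"
proof (rule partition_onI)
  have "(i, 1) \<in> {i} \<times> {1..k}" for i :: nat using assms by simp
  then show "{} \<notin> rows j k"
    unfolding rows_def by (metis (no_types, lifting) empty_iff imageE)
qed (auto simp: grid_def rows_def disjnt_def)

text \<open>The blocks of the common refinement are the nonempty intersections of a block of \<rho>
  with a row, and a row is a fibre of \<open>fst\<close> on the grid. They are all singletons
  exactly when \<open>fst\<close> is injective on every block, which is the form of non-flatness
  used from here on.\<close>

lemma non_flat_partitions_iff: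
  assumes "k \<ge> 1"
  shows "\<rho> \<in> non_flat_partitions j k \<longleftrightarrow> partition_on (grid j k) \<rho> \<and> (\<forall>b\<in>\<rho>. inj_on fst b)"
proof (intro iffI conjI ballI)
  assume \<rho>: "\<rho> \<in> non_flat_partitions j k"
  show part: "partition_on (grid j k) \<rho>"
    using \<rho> by (simp add: non_flat_partitions_def)
  fix b assume b: "b \<in> \<rho>"
  show "inj_on fst b"
  proof (rule inj_onI)
    fix p q assume pq: "p \<in> b" "q \<in> b" "fst p = fst q"
    define r where "r = {fst p} \<times> {1..k}"
    have grid: "p \<in> grid j k" "q \<in> grid j k"
      using pq b partition_onD1[OF part] by auto
    have r: "r \<in> rows j k" "p \<in> r" "q \<in> r"
      using grid pq by (auto simp: r_def grid_def rows_def)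
    \<comment> \<open>Members of a common refinement arise by choosing one block from each partition
      and intersecting; \<open>F\<close> is the choice of \<open>b\<close> and \<open>r\<close>. If
      \<rho> happens to be \<open>rows j k\<close>, the family collapses to a single partition and
      only \<open>b\<close> is chosen, so \<open>b = r\<close> must be checked; it holds because
      both blocks contain \<open>p\<close>.\<close>
    define F where "F = (\<lambda>R. if R = \<rho> then b else r)"
    have "b = r" if "\<rho> = rows j k"
      using that b r pq partition_onD2[OF part] by (auto dest: disjointD)
    then have F: "F \<in> (\<Pi> R\<in>{\<rho>, rows j k}. R)" "\<Inter>(F ` {\<rho>, rows j k}) = b \<inter> r"
      using b r by (auto simp: F_def)
    then have "b \<inter> r \<in> common_refinement {\<rho>, rows j k}"
      unfolding common_refinement using pq r by (auto intro!: bexI[of _ F])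
    then have "b \<inter> r \<in> (\<lambda>p. {p}) ` grid j k"
      using \<rho> by (simp add: non_flat_partitions_def)
    then obtain x where "b \<inter> r = {x}" by blast
    then show "p = q" using pq r by (metis IntI singletonD)
  qed
next
  assume "partition_on (grid j k) \<rho> \<and> (\<forall>b\<in>\<rho>. inj_on fst b)"
  then have part: "partition_on (grid j k) \<rho>" and inj: "\<And>b. b \<in> \<rho> \<Longrightarrow> inj_on fst b" by auto
  have C: "partition_on (grid j k) (common_refinement {\<rho>, rows j k})"
    using part partition_on_rows[OF assms] by (intro partition_on_common_refinement) auto
  \<comment> \<open>A member of the refinement lies inside one block and inside one row. The row
    fixes the first coordinate, and injectivity of \<open>fst\<close> on the block then leaves only
    one point.\<close>
  have single: "X = {p}" if X: "X \<in> common_refinement {\<rho>, rows j k}" "p \<in> X" for X p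
  proof -
    obtain b r where "b \<in> \<rho>" "r \<in> rows j k" "X \<subseteq> b" "X \<subseteq> r"
      using common_refinement_exists[OF X(1)] by (metis insertI1 insertI2)
    have "q = p" if q: "q \<in> X" for q
    proof -
      have "fst q = fst p"
        using q X(2) \<open>r \<in> rows j k\<close> \<open>X \<subseteq> r\<close> by (fastforce simp: rows_def)
      then show ?thesis
        using inj[OF \<open>b \<in> \<rho>\<close>] q X(2) \<open>X \<subseteq> b\<close> by (auto dest: inj_onD)
    qed
    then show ?thesis using X(2) by blast
  qed
  have "common_refinement {\<rho>, rows j k} = (\<lambda>p. {p}) ` grid j k"
  proof (intro equalityI subsetI)
    fix X assume X: "X \<in> common_refinement {\<rho>, rows j k}"
    have "X \<noteq> {}" using X partition_onD3[OF C] by auto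
    then obtain p where "p \<in> X" by auto
    then show "X \<in> (\<lambda>p. {p}) ` grid j k"
      using single[OF X] partition_onD1[OF C] X by blast
  next
    fix X assume "X \<in> (\<lambda>p. {p}) ` grid j k"
    then obtain p where "X = {p}" "p \<in> grid j k" by auto
    \<comment> \<open>The refinement covers the grid, so some member of it contains
      \<open>p\<close>, and by \<open>single\<close> that member is \<open>{p}\<close>.\<close>
    then show "X \<in> common_refinement {\<rho>, rows j k}"
      using single[OF block_of_in[OF C]] block_of_in[OF C] by simp
  qed
  with part show "\<rho> \<in> non_flat_partitions j k" by (simp add: non_flat_partitions_def)
qed

text \<open>A common block would contain two points with the same first coordinate. This keeps rows
  injective after labelling, and it ensures that two cells of a row span an edge and not a
  loop.\<close>

lemma block_of_row_neq:
  assumes "k \<ge> 1" "\<rho> \<in> non_flat_partitions j k"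
    and "i \<in> {1..j}" "u \<in> {1..k}" "v \<in> {1..k}" "u \<noteq> v"
  shows "block_of \<rho> (i, u) \<noteq> block_of \<rho> (i, v)"
proof
  assume eq: "block_of \<rho> (i, u) = block_of \<rho> (i, v)"
  have part: "partition_on (grid j k) \<rho>" and "\<forall>b\<in>\<rho>. inj_on fst b"
    using assms non_flat_partitions_iff by auto
  moreover have "(i, u) \<in> grid j k" "(i, v) \<in> grid j k" using assms by (auto simp: grid_def)
  ultimately have "inj_on fst (block_of \<rho> (i, u))" "(i, u) \<in> block_of \<rho> (i, u)" "(i, v) \<in> block_of \<rho> (i, u)"
    using block_of_in[OF part] eq by auto
  then have "(i, u) = (i, v)" by (metis inj_onD fst_conv)
  with \<open>u \<noteq> v\<close> show False by simp
qed

section \<open>Injective labellings of blocks\<close>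

text \<open>Extensional maps are taken so that a labelling is determined by its values on the
  blocks. This makes the set finite and the decomposition of row-injective maps unique.\<close>

definition labellings :: "nat \<Rightarrow> 'a set \<Rightarrow> ('a \<Rightarrow> nat) set" where
  "labellings n \<rho> = {\<gamma> \<in> \<rho> \<rightarrow>\<^sub>E {1..n}. inj_on \<gamma> \<rho>}"

lemma labellingsD:
  assumes "\<gamma> \<in> labellings n \<rho>"
  shows "inj_on \<gamma> \<rho>" "\<And>b. b \<in> \<rho> \<Longrightarrow> \<gamma> b \<in> {1..n}"
  using assms by (auto simp: labellings_def)

lemma card_labellings:
  assumes "finite \<rho>"
  shows "real (card (labellings n \<rho>)) = falling_factorial n (card \<rho>)"
proof -
  have "card (labellings n \<rho>) = (\<Prod>i<card \<rho>. n - i)"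
    using card_inj_on_subset_funcset[OF assms, of "{1..n}" \<rho>]
    by (simp add: labellings_def atLeast0LessThan)
  also have "real \<dots> = falling_factorial n (card \<rho>)"
  proof (cases "card \<rho> \<le> n")
    case True
    then show ?thesis
      by (auto simp: falling_factorial_def of_nat_diff intro!: prod.cong)
  next
    case False
    then have "n < card \<rho>" by simp
    \<comment> \<open>Factors with \<open>i > n\<close> differ, because subtraction on
      \<open>nat\<close> is truncated, but both products contain the vanishing factor at
      \<open>i = n\<close>.\<close>
    then have "(\<Prod>i<card \<rho>. real (n - i)) = 0" "(\<Prod>i<card \<rho>. real n - real i) = 0"
      by (auto intro!: prod_zero bexI[of _ n])
    then show ?thesis by (simp only: falling_factorial_def of_nat_prod)
  qed
  finally show ?thesis .
qed

section \<open>The bijection between labelled partitions and row-injective maps\<close>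

text \<open>Both arguments are restricted, so that the result is an extensional family of
  extensional tuples, as the target of the bijection requires.\<close>

definition glue :: "nat \<Rightarrow> nat \<Rightarrow> (nat \<times> nat) set set \<times> ((nat \<times> nat) set \<Rightarrow> nat) \<Rightarrow> nat \<Rightarrow> nat \<Rightarrow> nat" where
  "glue j k = (\<lambda>(\<rho>, \<gamma>). \<lambda>i\<in>{1..j}. \<lambda>l\<in>{1..k}. \<gamma> (block_of \<rho> (i, l)))"

lemma glue_apply:
  "p \<in> grid j k \<Longrightarrow> glue j k (\<rho>, \<gamma>) (fst p) (snd p) = \<gamma> (block_of \<rho> p)"
  by (cases p) (auto simp: glue_def grid_def)

text \<open>Since \<gamma> is injective on the blocks, two cells receive the same value exactly when
  they share a block. The glued map therefore determines \<rho>, which is the main half of the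
  injectivity of \<open>glue\<close>.\<close>

lemma blocks_eq_glue_fibres:
  assumes "partition_on (grid j k) \<rho>" "\<gamma> \<in> labellings n \<rho>"
  shows "\<rho> = (\<lambda>p. {q \<in> grid j k. glue j k (\<rho>, \<gamma>) (fst q) (snd q) = glue j k (\<rho>, \<gamma>) (fst p) (snd p)}) ` grid j k"
    (is "_ = ?F ` _")
proof -
  have F: "block_of \<rho> p = ?F p" if p: "p \<in> grid j k" for p
  proof -
    have "q \<in> block_of \<rho> p \<longleftrightarrow> q \<in> grid j k \<and> block_of \<rho> q = block_of \<rho> p" for q
      using block_of_in[OF assms(1)] p block_of_eq[OF assms(1)] partition_onD1[OF assms(1)] by blast
    moreover have "\<gamma> (block_of \<rho> q) = \<gamma> (block_of \<rho> p) \<longleftrightarrow> block_of \<rho> q = block_of \<rho> p"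
      if "q \<in> grid j k" for q
      using that p block_of_in(1)[OF assms(1)] labellingsD(1)[OF assms(2)] by (simp add: inj_on_eq_iff)
    ultimately show ?thesis
      using p by (intro set_eqI) (simp add: glue_apply cong: conj_cong)
  qed
  have "\<rho> = block_of \<rho> ` grid j k"
  proof (intro equalityI subsetI)
    fix b assume b: "b \<in> \<rho>"
    then obtain p where "p \<in> b" using partition_onD3[OF assms(1)] by (metis ex_in_conv)
    then show "b \<in> block_of \<rho> ` grid j k"
      using b block_of_eq[OF assms(1)] partition_onD1[OF assms(1)] by blast
  qed (use block_of_in[OF assms(1)] in auto)
  also have "\<dots> = ?F ` grid j k" by (intro image_cong refl F)
  finally show ?thesis .
qed

lemma inj_on_glue:
  assumes "k \<ge> 1"
  shows "inj_on (glue j k) (Sigma (non_flat_partitions j k) (labellings n))"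
proof (rule inj_onI)
  fix a b assume "a \<in> Sigma (non_flat_partitions j k) (labellings n)"
    "b \<in> Sigma (non_flat_partitions j k) (labellings n)" and eq: "glue j k a = glue j k b"
  then obtain \<rho> \<gamma> \<rho>' \<gamma>' where ab: "a = (\<rho>, \<gamma>)" "b = (\<rho>', \<gamma>')"
    and \<rho>: "partition_on (grid j k) \<rho>" "\<gamma> \<in> labellings n \<rho>"
    and \<rho>': "partition_on (grid j k) \<rho>'" "\<gamma>' \<in> labellings n \<rho>'"
    using non_flat_partitions_iff[OF assms] by auto
  have "\<rho> = \<rho>'"
    using blocks_eq_glue_fibres[OF \<rho>] blocks_eq_glue_fibres[OF \<rho>'] eq ab by simp
  \<comment> \<open>Blocks are nonempty, so the label of a block can be read off from the glued map
    at any of its cells.\<close>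
  moreover have "\<gamma> c = \<gamma>' c" if c: "c \<in> \<rho>" for c
  proof -
    obtain p where p: "p \<in> c" using c partition_onD3[OF \<rho>(1)] by (metis ex_in_conv)
    then have "p \<in> grid j k" "block_of \<rho> p = c"
      using c block_of_eq[OF \<rho>(1)] partition_onD1[OF \<rho>(1)] by auto
    then show ?thesis
      using eq glue_apply[of p j k \<rho> \<gamma>] glue_apply[of p j k \<rho> \<gamma>'] ab \<open>\<rho> = \<rho>'\<close> by simp
  qed
  then have "\<gamma> = \<gamma>'"
    using \<rho>(2) \<rho>'(2) \<open>\<rho> = \<rho>'\<close> by (intro extensionalityI[of _ \<rho>]) (auto simp: labellings_def PiE_def)
  ultimately show "a = b" using ab by simp
qed

text \<open>Non-flatness puts the cells of a row into distinct blocks, and injectivity of \<gamma>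
  turns these into distinct labels.\<close>

lemma glue_in:
  assumes "k \<ge> 1" "\<rho> \<in> non_flat_partitions j k" "\<gamma> \<in> labellings n \<rho>"
  shows "glue j k (\<rho>, \<gamma>) \<in> {1..j} \<rightarrow>\<^sub>E inj_tuples n k"
proof -
  have part: "partition_on (grid j k) \<rho>"
    using assms non_flat_partitions_iff by auto
  have B: "block_of \<rho> (i, l) \<in> \<rho>" if "i \<in> {1..j}" "l \<in> {1..k}" for i l
    using that by (intro block_of_in[OF part]) (auto simp: grid_def)
  have "inj_on (\<lambda>l. \<gamma> (block_of \<rho> (i, l))) {1..k}" if i: "i \<in> {1..j}" for i
    using block_of_row_neq[OF assms(1,2) i] B[OF i] labellingsD(1)[OF assms(3)]
    by (intro inj_onI) (metis inj_onD)
  moreover have "\<gamma> (block_of \<rho> (i, l)) \<in> {1..n}" if "i \<in> {1..j}" "l \<in> {1..k}" for i l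
    using labellingsD(2)[OF assms(3)] B that by blast
  ultimately show ?thesis
    by (fastforce simp: glue_def inj_tuples_def)
qed

text \<open>The preimage is the partition of the grid into the fibres of \<open>B\<close>, each
  labelled by the value of \<open>B\<close> on it. Injectivity of \<open>B\<close> on the rows is
  what makes this partition non-flat.\<close>

lemma glue_surj:
  assumes "k \<ge> 1" and B: "B \<in> {1..j} \<rightarrow>\<^sub>E inj_tuples n k"
  shows "B \<in> glue j k ` Sigma (non_flat_partitions j k) (labellings n)"
proof -
  define h where "h = (\<lambda>p. B (fst p) (snd p))"
  define F where "F = (\<lambda>p. {q \<in> grid j k. h q = h p})"
  define \<rho> where "\<rho> = F ` grid j k"
  \<comment> \<open>The map \<open>h\<close> is constant on each fibre, so the image of a block is a
    singleton and \<open>the_elem\<close> returns the common value.\<close>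
  define \<gamma> where "\<gamma> = (\<lambda>b\<in>\<rho>. the_elem (h ` b))"
  have part: "partition_on (grid j k) \<rho>"
    by (intro partition_onI) (auto simp: \<rho>_def F_def disjnt_def)
  have bl: "block_of \<rho> p = F p" if "p \<in> grid j k" for p
    using that by (intro block_of_eq[OF part]) (auto simp: \<rho>_def F_def)
  have Bi: "inj_on (B i) {1..k}" "B i \<in> {1..k} \<rightarrow>\<^sub>E {1..n}" if "i \<in> {1..j}" for i
    using B that by (auto simp: inj_tuples_def)
  have "inj_on fst (F p)" for p
  proof (rule inj_onI)
    fix q r assume qr: "q \<in> F p" "r \<in> F p" "fst q = fst r"
    then have "B (fst q) (snd q) = B (fst q) (snd r)" "fst q \<in> {1..j}" "snd q \<in> {1..k}" "snd r \<in> {1..k}"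
      by (auto simp: F_def h_def grid_def)
    then have "snd q = snd r" using Bi(1) by (metis inj_onD)
    with qr show "q = r" by (simp add: prod_eq_iff)
  qed
  then have nf: "\<rho> \<in> non_flat_partitions j k"
    using part non_flat_partitions_iff[OF assms(1)] by (auto simp: \<rho>_def)
  have \<gamma>: "\<gamma> (F p) = h p" if p: "p \<in> grid j k" for p
  proof -
    have "h ` F p = {h p}" using p by (auto simp: F_def)
    then show ?thesis using p by (simp add: \<gamma>_def \<rho>_def)
  qed
  have h: "h p \<in> {1..n}" if "p \<in> grid j k" for p
    unfolding h_def using that by (intro PiE_mem[OF Bi(2)]) (auto simp: grid_def)
  have "\<gamma> \<in> labellings n \<rho>"
    unfolding labellings_def
  proof (intro CollectI conjI PiE_I inj_onI)
    fix b c assume "b \<in> \<rho>" "c \<in> \<rho>" "\<gamma> b = \<gamma> c"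
    then show "b = c" by (auto simp: \<rho>_def \<gamma>) (auto simp: F_def)
  qed (use \<gamma> h in \<open>auto simp: \<rho>_def \<gamma>_def\<close>)
  moreover have "glue j k (\<rho>, \<gamma>) = B"
  proof (rule extensionalityI[of _ "{1..j}"])
    fix i assume i: "i \<in> {1..j}"
    show "glue j k (\<rho>, \<gamma>) i = B i"
    proof (rule extensionalityI[of _ "{1..k}"])
      fix l assume "l \<in> {1..k}"
      then have "(i, l) \<in> grid j k" using i by (auto simp: grid_def)
      then show "glue j k (\<rho>, \<gamma>) i l = B i l"
        using glue_apply[of "(i, l)" j k \<rho> \<gamma>] bl \<gamma> by (simp add: h_def)
    qed (use i Bi in \<open>auto simp: glue_def PiE_def\<close>)
  qed (use B in \<open>auto simp: glue_def PiE_def\<close>)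
  ultimately show ?thesis using nf by (metis SigmaI image_eqI)
qed

lemma bij_betw_glue:
  assumes "k \<ge> 1"
  shows "bij_betw (glue j k) (Sigma (non_flat_partitions j k) (labellings n))
           ({1..j} \<rightarrow>\<^sub>E inj_tuples n k)"
  unfolding bij_betw_def
proof (intro conjI equalityI subsetI)
  fix B assume "B \<in> glue j k ` Sigma (non_flat_partitions j k) (labellings n)"
  then obtain \<rho> \<gamma> where "B = glue j k (\<rho>, \<gamma>)" "\<rho> \<in> non_flat_partitions j k" "\<gamma> \<in> labellings n \<rho>"
    by blast
  then show "B \<in> {1..j} \<rightarrow>\<^sub>E inj_tuples n k"
    using glue_in[OF assms] by simp
qed (rule inj_on_glue[OF assms] glue_surj[OF assms], assumption?)+

section \<open>Edges and the index pairs of their variables\<close>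

text \<open>The end labels of an edge in increasing order: the independent family is indexed by
  increasing pairs only. \<open>Min\<close> and \<open>Max\<close> of the image need no choice of a
  first endpoint of the unordered edge.\<close>

definition edge_pair :: "('a \<Rightarrow> nat) \<Rightarrow> 'a set \<Rightarrow> nat \<times> nat" where
  "edge_pair \<gamma> e = (Min (\<gamma> ` e), Max (\<gamma> ` e))"

lemma edge_pair_doubleton: "edge_pair \<gamma> {b, c} = (min (\<gamma> b) (\<gamma> c), max (\<gamma> b) (\<gamma> c))"
  by (simp add: edge_pair_def)

lemma edgesE:
  assumes "e \<in> edges j k \<rho>"
  obtains b c where "e = {b, c}" "b \<in> \<rho>" "c \<in> \<rho>" "b \<noteq> c"
  using assms unfolding edges_def by auto

lemma edge_pair_in_pairs:
  assumes "\<gamma> \<in> labellings n \<rho>"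
  shows "edge_pair \<gamma> \<in> edges j k \<rho> \<rightarrow> pairs n"
proof
  fix e assume "e \<in> edges j k \<rho>"
  then obtain b c where e: "e = {b, c}" "b \<in> \<rho>" "c \<in> \<rho>" "b \<noteq> c"
    by (rule edgesE)
  then have "\<gamma> b \<noteq> \<gamma> c" "\<gamma> b \<in> {1..n}" "\<gamma> c \<in> {1..n}"
    using labellingsD[OF assms] by (auto simp: inj_on_eq_iff)
  then show "edge_pair \<gamma> e \<in> pairs n"
    by (auto simp: e edge_pair_doubleton pairs_def min_def max_def)
qed

text \<open>A sorted pair determines the set of its two labels, and \<gamma>, being injective,
  recovers the edge from that set. Distinct edges thus use distinct members of the family
  \<open>Y\<close>.\<close>

lemma inj_on_edge_pair:
  assumes "\<gamma> \<in> labellings n \<rho>"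
  shows "inj_on (edge_pair \<gamma>) (edges j k \<rho>)"
proof (rule inj_onI)
  fix e e' assume e: "e \<in> edges j k \<rho>" "e' \<in> edges j k \<rho>" and eq: "edge_pair \<gamma> e = edge_pair \<gamma> e'"
  obtain b c where bc: "e = {b, c}" "b \<in> \<rho>" "c \<in> \<rho>" using e(1) by (rule edgesE)
  obtain b' c' where bc': "e' = {b', c'}" "b' \<in> \<rho>" "c' \<in> \<rho>" using e(2) by (rule edgesE)
  have "\<gamma> ` e = \<gamma> ` e'"
    using eq by (auto simp: bc bc' edge_pair_doubleton min_def max_def split: if_splits)
  then show "e = e'"
    using labellingsD(1)[OF assms] bc bc' by (subst (asm) inj_on_image_eq_iff) auto
qed

text \<open>Row \<open>i\<close> itself witnesses the edge. Consequently \<open>tensor_glued\<close>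
  reads its second argument, over \<open>pairs k\<close>, only at coordinates of the product space
  indexed by \<open>edges j k \<rho>\<close>.\<close>

lemma block_of_edge:
  assumes "k \<ge> 1" "\<rho> \<in> non_flat_partitions j k" "i \<in> {1..j}" "(u, v) \<in> pairs k"
  shows "{block_of \<rho> (i, u), block_of \<rho> (i, v)} \<in> edges j k \<rho>"
proof -
  have uv: "u \<in> {1..k}" "v \<in> {1..k}" "u \<noteq> v" using assms(4) by (auto simp: pairs_def)
  have part: "partition_on (grid j k) \<rho>" using assms non_flat_partitions_iff by auto
  have "(i, u) \<in> grid j k" "(i, v) \<in> grid j k" using assms uv by (auto simp: grid_def)
  note B = block_of_in[OF part this(1)] block_of_in[OF part this(2)]
  show ?thesis
    unfolding edges_def
  proof (rule CollectI, rule exI[of _ "block_of \<rho> (i, u)"], rule exI[of _ "block_of \<rho> (i, v)"],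
      intro conjI)
    show "\<exists>h\<in>{1..j}. \<exists>l1\<in>{1..k}. \<exists>l2\<in>{1..k}.
        l1 \<noteq> l2 \<and> (h, l1) \<in> block_of \<rho> (i, u) \<and> (h, l2) \<in> block_of \<rho> (i, v)"
      using assms(3) uv B by (intro bexI conjI)
  qed (use B block_of_row_neq[OF assms(1-3) uv] in simp_all)
qed

subsection \<open>Joint laws of subfamilies\<close>

lemma (in prob_space) distr_iid:
  assumes X: "indep_vars (\<lambda>_. \<mu>) X I" and law: "\<And>i. i \<in> I \<Longrightarrow> distr M \<mu> (X i) = \<mu>"
  shows "distr M (Pi\<^sub>M I (\<lambda>_. \<mu>)) (\<lambda>\<omega>. \<lambda>i\<in>I. X i \<omega>) = Pi\<^sub>M I (\<lambda>_. \<mu>)"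
proof (cases "I = {}")
  \<comment> \<open>The characterisation by the product law is for nonempty index sets. In the empty
    case, which occurs as \<open>pairs 1\<close>, both sides are the unit mass at the everywhere
    \<open>undefined\<close> function.\<close>
  case True
  let ?N = "count_space {\<lambda>_. undefined}"
  interpret D: prob_space "distr M ?N (\<lambda>_. (\<lambda>_. undefined))"
    by (rule prob_space_distr) simp
  have "distr M ?N (\<lambda>_. (\<lambda>_. undefined)) = ?N"
    using D.emeasure_space_1
    by (intro measure_eqI_finite[where A = "{\<lambda>_. undefined}"]) auto
  then show ?thesis
    by (simp add: True PiM_empty restrict_def)
next
  case False
  have rv: "\<And>i. i \<in> I \<Longrightarrow> random_variable \<mu> (X i)"
    using X by (simp add: indep_vars_def)
  have "distr M (Pi\<^sub>M I (\<lambda>_. \<mu>)) (\<lambda>\<omega>. \<lambda>i\<in>I. X i \<omega>) = (\<Pi>\<^sub>M i\<in>I. distr M \<mu> (X i))"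
    using indep_vars_iff_distr_eq_PiM'[OF False rv] X by auto
  also have "\<dots> = Pi\<^sub>M I (\<lambda>_. \<mu>)"
    using law by (intro PiM_cong) auto
  finally show ?thesis .
qed

text \<open>The library's \<open>indep_var\<close> forces both variables to have the same value type.\<close>

lemma (in prob_space) distr_Pair_indep_set:
  assumes X: "random_variable S X" and Y: "random_variable T Y"
    and indep: "indep_set (sets (vimage_algebra (space M) X S)) (sets (vimage_algebra (space M) Y T))"
  shows "distr M S X \<Otimes>\<^sub>M distr M T Y = distr M (S \<Otimes>\<^sub>M T) (\<lambda>\<omega>. (X \<omega>, Y \<omega>))"
\<comment> \<open>The two laws are sigma-finite, so it suffices to compare measurable rectangles,
  where independence factors the probability.\<close>
proof (rule pair_measure_eqI)
  have XY: "random_variable (S \<Otimes>\<^sub>M T) (\<lambda>\<omega>. (X \<omega>, Y \<omega>))"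
    using X Y by (rule measurable_Pair)
  show "sigma_finite_measure (distr M S X)" "sigma_finite_measure (distr M T Y)"
    using X Y by (auto intro!: prob_space_imp_sigma_finite prob_space_distr)
  fix A B assume "A \<in> sets (distr M S X)" "B \<in> sets (distr M T Y)"
  then have AB: "A \<in> sets S" "B \<in> sets T" by auto
  have "emeasure (distr M (S \<Otimes>\<^sub>M T) (\<lambda>\<omega>. (X \<omega>, Y \<omega>))) (A \<times> B)
      = emeasure M ((\<lambda>\<omega>. (X \<omega>, Y \<omega>)) -` (A \<times> B) \<inter> space M)"
    using AB by (intro emeasure_distr[OF XY]) auto
  also have "(\<lambda>\<omega>. (X \<omega>, Y \<omega>)) -` (A \<times> B) \<inter> space M = (X -` A \<inter> space M) \<inter> (Y -` B \<inter> space M)"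
    by auto
  also have "emeasure M \<dots> = emeasure M (X -` A \<inter> space M) * emeasure M (Y -` B \<inter> space M)"
    using indep_setD[OF indep in_vimage_algebra[OF AB(1)] in_vimage_algebra[OF AB(2)]]
    by (simp add: emeasure_eq_measure ennreal_mult)
  also have "\<dots> = emeasure (distr M S X) A * emeasure (distr M T Y) B"
    using AB X Y by (simp add: emeasure_distr)
  finally show "emeasure (distr M S X) A * emeasure (distr M T Y) B
      = emeasure (distr M (S \<Otimes>\<^sub>M T) (\<lambda>\<omega>. (X \<omega>, Y \<omega>))) (A \<times> B)" ..
qed simp

text \<open>The full pair of families has a product law, and the selected subfamilies are its image
  under a reindexing of coordinates. Their law is therefore obtained by pushing the full product
  forward, without a separate independence argument for each selection.\<close>

lemma (in prob_space) distr_iid_subfamilies: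
  fixes X :: "'i \<Rightarrow> 'a \<Rightarrow> 's" and Z :: "'l \<Rightarrow> 'a \<Rightarrow> 'm"
  assumes \<mu>: "prob_space \<mu>" and Q: "prob_space Q"
    and X: "indep_vars (\<lambda>_. \<mu>) X I" "\<And>i. i \<in> I \<Longrightarrow> distr M \<mu> (X i) = \<mu>"
    and Z: "indep_vars (\<lambda>_. Q) Z L" "\<And>l. l \<in> L \<Longrightarrow> distr M Q (Z l) = Q"
    and indep: "indep_set
           (sets (vimage_algebra (space M) (\<lambda>\<omega>. \<lambda>i\<in>I. X i \<omega>) (Pi\<^sub>M I (\<lambda>_. \<mu>))))
           (sets (vimage_algebra (space M) (\<lambda>\<omega>. \<lambda>l\<in>L. Z l \<omega>) (Pi\<^sub>M L (\<lambda>_. Q))))"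
    and g: "inj_on g J" "g \<in> J \<rightarrow> I" and h: "inj_on h K" "h \<in> K \<rightarrow> L"
  shows "(\<lambda>\<omega>. (\<lambda>b\<in>J. X (g b) \<omega>, \<lambda>e\<in>K. Z (h e) \<omega>)) \<in> M \<rightarrow>\<^sub>M Pi\<^sub>M J (\<lambda>_. \<mu>) \<Otimes>\<^sub>M Pi\<^sub>M K (\<lambda>_. Q)"
      (is "?W \<in> _ \<rightarrow>\<^sub>M ?J \<Otimes>\<^sub>M ?K")
    and "distr M (Pi\<^sub>M J (\<lambda>_. \<mu>) \<Otimes>\<^sub>M Pi\<^sub>M K (\<lambda>_. Q)) (\<lambda>\<omega>. (\<lambda>b\<in>J. X (g b) \<omega>, \<lambda>e\<in>K. Z (h e) \<omega>))
       = Pi\<^sub>M J (\<lambda>_. \<mu>) \<Otimes>\<^sub>M Pi\<^sub>M K (\<lambda>_. Q)"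
proof -
  let ?I = "Pi\<^sub>M I (\<lambda>_. \<mu>)" and ?L = "Pi\<^sub>M L (\<lambda>_. Q)"
  let ?X = "\<lambda>\<omega>. \<lambda>i\<in>I. X i \<omega>" and ?Z = "\<lambda>\<omega>. \<lambda>l\<in>L. Z l \<omega>"
  have rvX: "random_variable \<mu> (X i)" if "i \<in> I" for i
    using X(1) that by (simp add: indep_vars_def)
  have rvZ: "random_variable Q (Z l)" if "l \<in> L" for l
    using Z(1) that by (simp add: indep_vars_def)
  show W: "?W \<in> M \<rightarrow>\<^sub>M ?J \<Otimes>\<^sub>M ?K"
    using rvX rvZ g(2) h(2) by (intro measurable_Pair measurable_restrict) auto
  have mX: "random_variable ?I ?X" and mZ: "random_variable ?L ?Z"
    using rvX rvZ by (auto intro!: measurable_restrict)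
  have joint: "?I \<Otimes>\<^sub>M ?L = distr M (?I \<Otimes>\<^sub>M ?L) (\<lambda>\<omega>. (?X \<omega>, ?Z \<omega>))"
    using distr_Pair_indep_set[OF mX mZ indep] by (simp add: distr_iid[OF X] distr_iid[OF Z])
  let ?g = "\<lambda>x. \<lambda>b\<in>J. x (g b)" and ?h = "\<lambda>z. \<lambda>e\<in>K. z (h e)"
  have mg: "?g \<in> ?I \<rightarrow>\<^sub>M ?J" and mh: "?h \<in> ?L \<rightarrow>\<^sub>M ?K"
    using g(2) h(2) by (auto intro!: measurable_restrict measurable_component_singleton)
  \<comment> \<open>Injectivity of \<open>g\<close> and \<open>h\<close> enters here: a repeated
    index would produce equal coordinates in place of independent ones.\<close>
  have dg: "distr ?I ?J ?g = ?J" and dh: "distr ?L ?K ?h = ?K"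
    using distr_PiM_reindex[of I "\<lambda>_. \<mu>" g J] distr_PiM_reindex[of L "\<lambda>_. Q" h K] \<mu> Q g h by auto
  have "sigma_finite_measure ?K"
    using prob_space_PiM[of K "\<lambda>_. Q"] Q by (simp add: prob_space_imp_sigma_finite)
  then have "?J \<Otimes>\<^sub>M ?K = distr (?I \<Otimes>\<^sub>M ?L) (?J \<Otimes>\<^sub>M ?K) (\<lambda>(x, z). (?g x, ?h z))"
    using pair_measure_distr[OF mg mh] by (simp add: dg dh)
  also have "\<dots> = distr M (?J \<Otimes>\<^sub>M ?K) ((\<lambda>(x, z). (?g x, ?h z)) \<circ> (\<lambda>\<omega>. (?X \<omega>, ?Z \<omega>)))"
  proof (subst joint, rule distr_distr)
    show "(\<lambda>\<omega>. (?X \<omega>, ?Z \<omega>)) \<in> M \<rightarrow>\<^sub>M ?I \<Otimes>\<^sub>M ?L"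
      using mX mZ by (rule measurable_Pair)
    show "(\<lambda>(x, z). (?g x, ?h z)) \<in> ?I \<Otimes>\<^sub>M ?L \<rightarrow>\<^sub>M ?J \<Otimes>\<^sub>M ?K"
      using measurable_compose[OF measurable_fst mg] measurable_compose[OF measurable_snd mh]
      unfolding split_beta' by (rule measurable_Pair)
  qed
  also have "(\<lambda>(x, z). (?g x, ?h z)) \<circ> (\<lambda>\<omega>. (?X \<omega>, ?Z \<omega>)) = ?W"
    using g(2) h(2) by (auto simp: fun_eq_iff restrict_def)
  finally show "distr M (?J \<Otimes>\<^sub>M ?K) ?W = ?J \<Otimes>\<^sub>M ?K" ..
qed

subsection \<open>The moment formula\<close>

lemma measurable_glued_arguments:
  assumes "k \<ge> 1" "\<rho> \<in> non_flat_partitions j k" "i \<in> {1..j}"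
  shows "(\<lambda>(x, y). (\<lambda>l\<in>{1..k}. x (block_of \<rho> (i, l)),
           \<lambda>(u, v)\<in>pairs k. y {block_of \<rho> (i, u), block_of \<rho> (i, v)}))
         \<in> Pi\<^sub>M \<rho> (\<lambda>_. S) \<Otimes>\<^sub>M Pi\<^sub>M (edges j k \<rho>) (\<lambda>_. T) \<rightarrow>\<^sub>M kernel_domain k S T"
  unfolding kernel_domain_def split_beta'
proof (intro measurable_Pair measurable_restrict)
  have part: "partition_on (grid j k) \<rho>" using assms non_flat_partitions_iff by auto
  fix l assume "l \<in> {1..k}"
  then have "block_of \<rho> (i, l) \<in> \<rho>"
    using assms(3) by (intro block_of_in[OF part]) (auto simp: grid_def)
  then show "(\<lambda>z. fst z (block_of \<rho> (i, l))) \<in> Pi\<^sub>M \<rho> (\<lambda>_. S) \<Otimes>\<^sub>M Pi\<^sub>M (edges j k \<rho>) (\<lambda>_. T) \<rightarrow>\<^sub>M S"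
    by (intro measurable_compose[OF measurable_fst] measurable_component_singleton)
next
  fix p assume "p \<in> pairs k"
  then have "{block_of \<rho> (i, fst p), block_of \<rho> (i, snd p)} \<in> edges j k \<rho>"
    using block_of_edge[OF assms] by simp
  then show "(\<lambda>z. snd z {block_of \<rho> (i, fst p), block_of \<rho> (i, snd p)})
      \<in> Pi\<^sub>M \<rho> (\<lambda>_. S) \<Otimes>\<^sub>M Pi\<^sub>M (edges j k \<rho>) (\<lambda>_. T) \<rightarrow>\<^sub>M T"
    by (intro measurable_compose[OF measurable_snd] measurable_component_singleton)
qed

text \<open>A product of \<open>j\<close> factors bounded by \<open>C\<close> is bounded by
  \<open>C ^ j\<close>, and a bounded measurable function is integrable over a probability
  space.\<close>

lemma integrable_tensor_glued:
  fixes S :: "'s measure" and T :: "'m measure"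
  assumes "k \<ge> 1" "\<rho> \<in> non_flat_partitions j k"
    and "prob_space S" "prob_space T"
    and f: "f \<in> borel_measurable (kernel_domain k S T)"
    and bdd: "bounded (f ` space (kernel_domain k S T))"
  shows "integrable (Pi\<^sub>M \<rho> (\<lambda>_. S) \<Otimes>\<^sub>M Pi\<^sub>M (edges j k \<rho>) (\<lambda>_. T)) (tensor_glued j k f \<rho>)"
proof -
  let ?N = "Pi\<^sub>M \<rho> (\<lambda>_. S) \<Otimes>\<^sub>M Pi\<^sub>M (edges j k \<rho>) (\<lambda>_. T)"
  define G where "G i = (\<lambda>(x :: (nat \<times> nat) set \<Rightarrow> 's, y :: (nat \<times> nat) set set \<Rightarrow> 'm). (\<lambda>l\<in>{1..k}. x (block_of \<rho> (i, l)),
           \<lambda>(u, v)\<in>pairs k. y {block_of \<rho> (i, u), block_of \<rho> (i, v)}))" for i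
  have G: "G i \<in> ?N \<rightarrow>\<^sub>M kernel_domain k S T" if "i \<in> {1..j}" for i
    unfolding G_def using measurable_glued_arguments[OF assms(1,2) that] .
  have eq: "tensor_glued j k f \<rho> = (\<lambda>z. \<Prod>i\<in>{1..j}. f (G i z))"
    by (simp add: tensor_glued_def G_def split_beta')
  interpret prob_space ?N
    using assms(3,4) by (intro prob_space_pair prob_space_PiM)
  obtain C where C: "\<And>z. z \<in> space (kernel_domain k S T) \<Longrightarrow> \<bar>f z\<bar> \<le> C"
    using bdd unfolding bounded_iff by auto
  show ?thesis
  proof (rule integrable_const_bound[where B = "C ^ j"])
    show "tensor_glued j k f \<rho> \<in> borel_measurable ?N"
      unfolding eq by (intro borel_measurable_prod measurable_compose[OF G f])
    show "AE z in ?N. norm (tensor_glued j k f \<rho> z) \<le> C ^ j"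
    proof (rule AE_I2)
      fix z assume z: "z \<in> space ?N"
      have "norm (tensor_glued j k f \<rho> z) = (\<Prod>i\<in>{1..j}. \<bar>f (G i z)\<bar>)"
        by (simp add: eq abs_prod)
      also have "\<dots> \<le> (\<Prod>i\<in>{1..j}. C)"
        \<comment> \<open>The bound on \<open>f\<close> is given only on the space of the kernel
          domain; measurability of \<open>G i\<close> places its values there.\<close>
        using C measurable_space[OF G z] by (intro prod_mono) auto
      finally show "norm (tensor_glued j k f \<rho> z) \<le> C ^ j" by simp
    qed
  qed
qed

lemma gen_U_statistic_power:
  assumes "k \<ge> 1"
  shows "gen_U_statistic n k f X Y \<omega> ^ j =
    (\<Sum>(\<rho>, \<gamma>)\<in>Sigma (non_flat_partitions j k) (labellings n).
       \<Prod>i\<in>{1..j}. f (\<lambda>l\<in>{1..k}. X (glue j k (\<rho>, \<gamma>) i l) \<omega>,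
         \<lambda>(u, v)\<in>pairs k. Y (glue j k (\<rho>, \<gamma>) i u) (glue j k (\<rho>, \<gamma>) i v) \<omega>))"
proof -
  define F where "F \<beta> = f (\<lambda>l\<in>{1..k}. X (\<beta> l) \<omega>, \<lambda>(u, v)\<in>pairs k. Y (\<beta> u) (\<beta> v) \<omega>)" for \<beta>
  have fin: "finite (inj_tuples n k)"
    by (rule finite_subset[of _ "{1..k} \<rightarrow>\<^sub>E {1..n}"]) (auto simp: inj_tuples_def intro: finite_PiE)
  \<comment> \<open>The power is written as a product over the rows, so that distributivity yields
    families indexed by \<open>{1..j}\<close>, the target of \<open>glue\<close>.\<close>
  have "gen_U_statistic n k f X Y \<omega> ^ j = (\<Prod>i\<in>{1..j}. \<Sum>\<beta>\<in>inj_tuples n k. F \<beta>)"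
    by (simp add: gen_U_statistic_def F_def)
  also have "\<dots> = (\<Sum>B\<in>{1..j} \<rightarrow>\<^sub>E inj_tuples n k. \<Prod>i\<in>{1..j}. F (B i))"
    using fin by (intro prod_sum_PiE) auto
  also have "\<dots> = (\<Sum>z\<in>Sigma (non_flat_partitions j k) (labellings n). \<Prod>i\<in>{1..j}. F (glue j k z i))"
    by (rule sum.reindex_bij_betw[OF bij_betw_glue[OF assms], symmetric])
  finally show ?thesis by (simp add: F_def split_beta)
qed

text \<open>Row by row, \<open>f\<close> receives the same arguments on both sides. The point to
  settle is orientation: a row may list two labels in decreasing order, while an edge variable is
  always stored at the increasing pair.\<close>

lemma prod_glue_eq_tensor_glued:
  assumes "k \<ge> 1" "\<rho> \<in> non_flat_partitions j k" "\<gamma> \<in> labellings n \<rho>"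
    and sym: "\<And>i l. (i, l) \<in> pairs n \<Longrightarrow> Y l i = Y i l"
  shows "(\<Prod>i\<in>{1..j}. f (\<lambda>l\<in>{1..k}. X (glue j k (\<rho>, \<gamma>) i l) \<omega>,
         \<lambda>(u, v)\<in>pairs k. Y (glue j k (\<rho>, \<gamma>) i u) (glue j k (\<rho>, \<gamma>) i v) \<omega>)) =
    tensor_glued j k f \<rho> (\<lambda>b\<in>\<rho>. X (\<gamma> b) \<omega>,
      \<lambda>e\<in>edges j k \<rho>. case_prod Y (edge_pair \<gamma> e) \<omega>)"
proof -
  have part: "partition_on (grid j k) \<rho>" using assms non_flat_partitions_iff by auto
  have glue: "glue j k (\<rho>, \<gamma>) i l = \<gamma> (block_of \<rho> (i, l))" if "i \<in> {1..j}" "l \<in> {1..k}" for i l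
    using that by (simp add: glue_def)
  have B: "block_of \<rho> (i, l) \<in> \<rho>" if "i \<in> {1..j}" "l \<in> {1..k}" for i l
    using that by (intro block_of_in[OF part]) (auto simp: grid_def)
  \<comment> \<open>The symmetry of \<open>Y\<close> covers the case where sorting swaps the two
    labels.\<close>
  have Y: "case_prod Y (edge_pair \<gamma> {b, c}) = Y (\<gamma> b) (\<gamma> c)" if "b \<in> \<rho>" "c \<in> \<rho>" for b c
    using that labellingsD(2)[OF assms(3)] sym[of "\<gamma> c" "\<gamma> b"]
    by (auto simp: edge_pair_doubleton pairs_def min_def max_def)
  have "f (\<lambda>l\<in>{1..k}. X (glue j k (\<rho>, \<gamma>) i l) \<omega>,
         \<lambda>(u, v)\<in>pairs k. Y (glue j k (\<rho>, \<gamma>) i u) (glue j k (\<rho>, \<gamma>) i v) \<omega>) =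
      f (\<lambda>l\<in>{1..k}. (\<lambda>b\<in>\<rho>. X (\<gamma> b) \<omega>) (block_of \<rho> (i, l)),
         \<lambda>(u, v)\<in>pairs k. (\<lambda>e\<in>edges j k \<rho>. case_prod Y (edge_pair \<gamma> e) \<omega>)
           {block_of \<rho> (i, u), block_of \<rho> (i, v)})" if i: "i \<in> {1..j}" for i
  proof -
    have "(\<lambda>(u, v). Y (glue j k (\<rho>, \<gamma>) i u) (glue j k (\<rho>, \<gamma>) i v) \<omega>) p =
      (\<lambda>(u, v). (\<lambda>e\<in>edges j k \<rho>. case_prod Y (edge_pair \<gamma> e) \<omega>)
           {block_of \<rho> (i, u), block_of \<rho> (i, v)}) p" if "p \<in> pairs k" for p
    proof -
      obtain u v where p: "p = (u, v)" by (cases p)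
      then have uv: "u \<in> {1..k}" "v \<in> {1..k}" using that by (auto simp: pairs_def)
      have e: "{block_of \<rho> (i, u), block_of \<rho> (i, v)} \<in> edges j k \<rho>"
        using block_of_edge[OF assms(1,2) i] that p by simp
      show ?thesis
        unfolding p prod.case restrict_apply'[OF e] glue[OF i uv(1)] glue[OF i uv(2)]
          Y[OF B[OF i uv(1)] B[OF i uv(2)]] ..
    qed
    then show ?thesis
      using glue B i by (intro arg_cong[of _ _ f] arg_cong2[of _ _ _ _ Pair] restrict_ext) auto
  qed
  then show ?thesis by (simp add: tensor_glued_def)
qed

theorem theorem3p2:
  fixes P :: "'w measure" and S \<mu> :: "'s measure" and T Q :: "'m measure"
    and X :: "nat \<Rightarrow> 'w \<Rightarrow> 's" and Y :: "nat \<Rightarrow> nat \<Rightarrow> 'w \<Rightarrow> 'm"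
    and f :: "(nat \<Rightarrow> 's) \<times> (nat \<times> nat \<Rightarrow> 'm) \<Rightarrow> real"
    and k j n :: nat
  assumes "k \<ge> 2" and "j \<ge> 1" and "n \<ge> 1"
    and "prob_space P"
    and "borel_space S"
    and "prob_space \<mu>" and "sets \<mu> = sets S" and "atomless \<mu>"
    and "prob_space Q" and "sets Q = sets T"
    and "prob_space.indep_vars P (\<lambda>_. S) X {1..n}"
    and "\<And>i. i \<in> {1..n} \<Longrightarrow> distr P S (X i) = \<mu>"
    and "prob_space.indep_vars P (\<lambda>_. T) (\<lambda>(i, l). Y i l) (pairs n)"
    and "\<And>i l. (i, l) \<in> pairs n \<Longrightarrow> distr P T (Y i l) = Q"
    and "prob_space.indep_set P
           (sets (vimage_algebra (space P) (\<lambda>\<omega>. \<lambda>i\<in>{1..n}. X i \<omega>) (Pi\<^sub>M {1..n} (\<lambda>_. S))))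
           (sets (vimage_algebra (space P) (\<lambda>\<omega>. \<lambda>(i, l)\<in>pairs n. Y i l \<omega>)
              (Pi\<^sub>M (pairs n) (\<lambda>_. T))))"
    and "\<And>i l. (i, l) \<in> pairs n \<Longrightarrow> Y l i = Y i l"
    and "f \<in> borel_measurable (kernel_domain k S T)"
    and "bounded (f ` space (kernel_domain k S T))"
  shows "(\<integral>\<omega>. (gen_U_statistic n k f X Y \<omega>) ^ j \<partial>P) =
    (\<Sum>\<rho>\<in>non_flat_partitions j k.
       falling_factorial n (card \<rho>) *
       (\<integral>z. tensor_glued j k f \<rho> z
          \<partial>(Pi\<^sub>M \<rho> (\<lambda>_. \<mu>) \<Otimes>\<^sub>M Pi\<^sub>M (edges j k \<rho>) (\<lambda>_. Q))))"
proof -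
  interpret P: prob_space P by fact
  have k: "k \<ge> 1" using assms(1) by simp
  have sets_S: "sets \<mu> = sets S" and sets_T: "sets Q = sets T" by fact+
  define Z where "Z = case_prod Y"
  let ?N = "\<lambda>\<rho>. Pi\<^sub>M \<rho> (\<lambda>_. \<mu>) \<Otimes>\<^sub>M Pi\<^sub>M (edges j k \<rho>) (\<lambda>_. Q)"
  let ?W = "\<lambda>\<rho> \<gamma> \<omega>. (\<lambda>b\<in>\<rho>. X (\<gamma> b) \<omega>, \<lambda>e\<in>edges j k \<rho>. Z (edge_pair \<gamma> e) \<omega>)"
  \<comment> \<open>The hypotheses refer to \<open>S\<close> and \<open>T\<close>, the integrals to
    \<mu> and \<open>Q\<close>. Measurability, laws and independence depend on the target space only
    through its sigma-algebra, so all hypotheses are restated over \<mu> and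
    \<open>Q\<close>.\<close>
  have dom: "sets (kernel_domain k S T) = sets (kernel_domain k \<mu> Q)"
    unfolding kernel_domain_def using sets_S sets_T
    by (intro sets_pair_measure_cong sets_PiM_cong) auto
  have f: "f \<in> borel_measurable (kernel_domain k \<mu> Q)"
    using assms(17) measurable_cong_sets[OF dom refl] by blast
  have bdd: "bounded (f ` space (kernel_domain k \<mu> Q))"
    using assms(18) sets_eq_imp_space_eq[OF dom] by simp
  have X: "P.indep_vars (\<lambda>_. \<mu>) X {1..n}"
    using assms(11) sets_S measurable_cong_sets[OF refl sets_S, of P]
    by (simp add: P.indep_vars_def)
  have Z: "P.indep_vars (\<lambda>_. Q) Z (pairs n)"
    using assms(13) sets_T measurable_cong_sets[OF refl sets_T, of P]
    by (simp add: P.indep_vars_def Z_def)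
  have lawX: "distr P \<mu> (X i) = \<mu>" if "i \<in> {1..n}" for i
    using assms(12)[OF that] distr_cong[OF refl sets_S, of P "X i" "X i"] by simp
  have lawZ: "distr P Q (Z p) = Q" if "p \<in> pairs n" for p
    using assms(14)[of "fst p" "snd p"] that distr_cong[OF refl sets_T, of P "Z p" "Z p"]
    by (simp add: Z_def split_beta)
  have Z_eq: "(\<lambda>\<omega>. \<lambda>(i, l)\<in>pairs n. Y i l \<omega>) = (\<lambda>\<omega>. \<lambda>p\<in>pairs n. Z p \<omega>)"
    by (auto simp: Z_def fun_eq_iff restrict_def)
  have "sets (Pi\<^sub>M {1..n} (\<lambda>_. \<mu>)) = sets (Pi\<^sub>M {1..n} (\<lambda>_. S))"
    "sets (Pi\<^sub>M (pairs n) (\<lambda>_. Q)) = sets (Pi\<^sub>M (pairs n) (\<lambda>_. T))"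
    using sets_S sets_T by (intro sets_PiM_cong refl; simp)+
  note vim = this[THEN sets_vimage_algebra_cong]
  have indep: "P.indep_set
           (sets (vimage_algebra (space P) (\<lambda>\<omega>. \<lambda>i\<in>{1..n}. X i \<omega>) (Pi\<^sub>M {1..n} (\<lambda>_. \<mu>))))
           (sets (vimage_algebra (space P) (\<lambda>\<omega>. \<lambda>p\<in>pairs n. Z p \<omega>) (Pi\<^sub>M (pairs n) (\<lambda>_. Q))))"
    using assms(15) unfolding vim Z_eq .
  \<comment> \<open>Distinct blocks and distinct edges select distinct members of the two
    independent families, so the law of the selected variables is the same product measure for every
    labelling of \<rho>.\<close>
  have W: "?W \<rho> \<gamma> \<in> P \<rightarrow>\<^sub>M ?N \<rho>" "distr P (?N \<rho>) (?W \<rho> \<gamma>) = ?N \<rho>"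
    if "\<gamma> \<in> labellings n \<rho>" for \<rho> \<gamma>
  proof -
    have g: "\<gamma> \<in> \<rho> \<rightarrow> {1..n}" using labellingsD(2)[OF that] by blast
    note law = P.distr_iid_subfamilies[OF assms(6,9) X lawX Z lawZ indep labellingsD(1)[OF that] g
        inj_on_edge_pair[OF that] edge_pair_in_pairs[OF that]]
    show "?W \<rho> \<gamma> \<in> P \<rightarrow>\<^sub>M ?N \<rho>" "distr P (?N \<rho>) (?W \<rho> \<gamma>) = ?N \<rho>"
      using law by simp_all
  qed
  have int: "integrable (?N \<rho>) (tensor_glued j k f \<rho>)" if "\<rho> \<in> non_flat_partitions j k" for \<rho>
    by (rule integrable_tensor_glued[OF k that assms(6,9) f bdd])
  have fin: "finite (non_flat_partitions j k)"
    by (rule finite_subset[OF _ finitely_many_partition_on[of "grid j k"]])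
      (auto simp: non_flat_partitions_def grid_def)
  have fin_\<rho>: "finite \<rho>" if "\<rho> \<in> non_flat_partitions j k" for \<rho>
    using that by (intro finite_elements[of "grid j k"]) (auto simp: non_flat_partitions_def grid_def)
  have fin_lab: "finite (labellings n \<rho>)" if "\<rho> \<in> non_flat_partitions j k" for \<rho>
    by (rule finite_subset[of _ "\<rho> \<rightarrow>\<^sub>E {1..n}"])
      (auto simp: labellings_def fin_\<rho>[OF that] intro!: finite_PiE)
  have "(\<integral>\<omega>. (gen_U_statistic n k f X Y \<omega>) ^ j \<partial>P) =
    (\<integral>\<omega>. (\<Sum>(\<rho>, \<gamma>)\<in>Sigma (non_flat_partitions j k) (labellings n). tensor_glued j k f \<rho> (?W \<rho> \<gamma> \<omega>)) \<partial>P)"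
    unfolding gen_U_statistic_power[OF k] Z_def
    by (intro Bochner_Integration.integral_cong refl sum.cong, clarify)
      (rule prod_glue_eq_tensor_glued[where Y = Y, OF k _ _ assms(16)])
  also have "\<dots> = (\<Sum>(\<rho>, \<gamma>)\<in>Sigma (non_flat_partitions j k) (labellings n).
      \<integral>\<omega>. tensor_glued j k f \<rho> (?W \<rho> \<gamma> \<omega>) \<partial>P)"
    unfolding split_beta'
  proof (rule Bochner_Integration.integral_sum)
    fix z assume "z \<in> Sigma (non_flat_partitions j k) (labellings n)"
    then have z: "fst z \<in> non_flat_partitions j k" "snd z \<in> labellings n (fst z)" by auto
    \<comment> \<open>Integrability under \<open>P\<close> is that of \<open>tensor_glued\<close>
      under the law of \<open>?W\<close>, which is the product measure.\<close>
    show "integrable P (\<lambda>\<omega>. tensor_glued j k f (fst z) (?W (fst z) (snd z) \<omega>))"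
      by (rule integrable_distr[OF W(1)[OF z(2)]]) (simp only: W(2)[OF z(2)] int[OF z(1)])
  qed
  also have "\<dots> = (\<Sum>(\<rho>, \<gamma>)\<in>Sigma (non_flat_partitions j k) (labellings n).
      \<integral>z. tensor_glued j k f \<rho> z \<partial>?N \<rho>)"
  proof (intro sum.cong refl, clarify)
    fix \<rho> \<gamma> assume \<rho>: "\<rho> \<in> non_flat_partitions j k" and \<gamma>: "\<gamma> \<in> labellings n \<rho>"
    show "(\<integral>\<omega>. tensor_glued j k f \<rho> (?W \<rho> \<gamma> \<omega>) \<partial>P) = (\<integral>z. tensor_glued j k f \<rho> z \<partial>?N \<rho>)"
      using integral_distr[OF W(1)[OF \<gamma>] borel_measurable_integrable[OF int[OF \<rho>]]] W(2)[OF \<gamma>]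
      by simp
  qed
  also have "\<dots> = (\<Sum>\<rho>\<in>non_flat_partitions j k. \<Sum>\<gamma>\<in>labellings n \<rho>. \<integral>z. tensor_glued j k f \<rho> z \<partial>?N \<rho>)"
    using fin fin_lab by (subst sum.Sigma) auto
  \<comment> \<open>The integral no longer involves \<gamma>, so the inner sum only counts
    labellings; the count is zero when \<rho> has more than \<open>n\<close> blocks.\<close>
  also have "\<dots> = (\<Sum>\<rho>\<in>non_flat_partitions j k.
       falling_factorial n (card \<rho>) * (\<integral>z. tensor_glued j k f \<rho> z \<partial>?N \<rho>))"
    by (intro sum.cong refl) (simp add: card_labellings[OF fin_\<rho>])
  finally show ?thesis .
qed

end
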